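(* Let $X$ be a Cantor space. In $C_s(X)$ the sets $\{ 1_X \}$ and $CM(X;1)$ are the only conjugacy minimal subsets.
   Context: A Cantor space is a nonempty, compact, zero-dimensional, perfect metric space (metric $d$). $C_s(X)$ is the space of continuous surjections $X\to X$ with the sup metric; the homeomorphism group $H(X)$ acts by $f\mapsto h\circ f\circ h^{-1}$, with orbits called conjugacy classes. $1_X$ is the identity map. With $V_\epsilon=\{(x,y):d(x,y)<\epsilon\}$ and maps identified with their graphs, $f$ is chain mixing if for every $\epsilon>0$ there is $N\ge1$ with $(V_\epsilon\circ f\circ V_\epsilon)^N=X\times X$ (composition of relations). $CM(X;1)$ is the set of chain mixing maps in $C_s(X)$ which admit a fixed point. A nonempty closed, conjugacy invariant set $K\subset C_s(X)$ is conjugacy minimal if for every $f\in K$ the closure of the conjugacy class of $f$ equals $K$. *)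

theory Defs
  imports "HOL-Analysis.Analysis"
begin

definition zero_dimensional :: "'a::topological_space set \<Rightarrow> bool" where
  "zero_dimensional X \<longleftrightarrow>
     (\<forall>U. openin (top_of_set X) U \<longrightarrow>
       (\<forall>x\<in>U. \<exists>C. openin (top_of_set X) C \<and> closedin (top_of_set X) C \<and> x \<in> C \<and> C \<subseteq> U))"

definition Cantor_space :: "'a::metric_space set \<Rightarrow> bool" where
  "Cantor_space X \<longleftrightarrow>
     X \<noteq> {} \<and> compact X \<and> zero_dimensional X \<and> (\<forall>x\<in>X. x islimpt X)"

text \<open>
  From here on the space is a whole type. The type of bounded continuous functions carries the
  sup metric; when \<^term>\<open>UNIV\<close> is compact, boundedness is automatic, so this type consists of
  all continuous self-maps.
\<close>

definition cont_surj :: "('a::metric_space \<Rightarrow>\<^sub>C 'a) set" where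
  "cont_surj = {f. surj (apply_bcontfun f)}"

text \<open>The identity map belongs to the type only if the space is bounded, e.g. compact.\<close>

definition id_map :: "'a::metric_space \<Rightarrow>\<^sub>C 'a" where
  "id_map = Bcontfun id"

lemma apply_id_map:
  assumes "compact (UNIV :: 'a::metric_space set)"
  shows "apply_bcontfun (id_map :: 'a \<Rightarrow>\<^sub>C 'a) = id"
  unfolding id_map_def
  by (rule Bcontfun_inverse) (use compact_imp_bounded[OF assms] in \<open>auto simp: bcontfun_def\<close>)

definition homeo_group :: "('a::topological_space \<Rightarrow> 'a) set" where
  "homeo_group = {h. homeomorphism UNIV UNIV h (inv h)}"

definition conj_class :: "('a::metric_space \<Rightarrow>\<^sub>C 'a) \<Rightarrow> ('a \<Rightarrow>\<^sub>C 'a) set" where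
  "conj_class f =
     {g. \<exists>h\<in>homeo_group. apply_bcontfun g = h \<circ> apply_bcontfun f \<circ> inv h}"

definition conj_invariant :: "('a::metric_space \<Rightarrow>\<^sub>C 'a) set \<Rightarrow> bool" where
  "conj_invariant K \<longleftrightarrow> (\<forall>f\<in>K. conj_class f \<subseteq> K)"

text \<open>Closedness and closure are taken in the space of continuous surjections.\<close>

definition conj_minimal :: "('a::metric_space \<Rightarrow>\<^sub>C 'a) set \<Rightarrow> bool" where
  "conj_minimal K \<longleftrightarrow>
     K \<noteq> {} \<and> closedin (top_of_set cont_surj) K \<and> conj_invariant K \<and>
     (\<forall>f\<in>K. top_of_set cont_surj closure_of conj_class f = K)"

definition V :: "real \<Rightarrow> ('a::metric_space \<times> 'a) set" where
  "V \<epsilon> = {(x, y). dist x y < \<epsilon>}"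

definition graph_of :: "('a \<Rightarrow> 'b) \<Rightarrow> ('a \<times> 'b) set" where
  "graph_of f = {(x, y). y = f x}"

text \<open>
  Relational composition \<^term>\<open>(O)\<close> is written in diagrammatic order; the composite below is
  symmetric in its outer factors, so the order convention is immaterial.
\<close>

definition chain_mixing :: "('a::metric_space \<Rightarrow> 'a) \<Rightarrow> bool" where
  "chain_mixing f \<longleftrightarrow>
     (\<forall>\<epsilon>>0. \<exists>N\<ge>1. (V \<epsilon> O graph_of f O V \<epsilon>) ^^ N = UNIV \<times> UNIV)"

definition CM1 :: "('a::metric_space \<Rightarrow>\<^sub>C 'a) set" where
  "CM1 = {f \<in> cont_surj. chain_mixing (apply_bcontfun f) \<and> (\<exists>x. apply_bcontfun f x = x)}"

end

theory Submission
  imports Defs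
begin

text \<open>
  Uniform distance on a Cantor space is a combinatorial matter. A locally constant map \<open>p\<close> (a
  finite clopen partition with names attached) turns a map \<open>g\<close> into a finite directed graph with
  edges \<open>(p x, p (g x))\<close>. If \<open>f\<close> can be coded by some locally constant \<open>q\<close> so that the same
  graph arises, then all the clopen pieces belonging to equal edges are Cantor spaces, hence
  homeomorphic, and gluing such homeomorphisms yields an \<open>h\<close> for which \<open>h \<circ> f \<circ> inv h\<close> and \<open>g\<close>
  send every point into the same cell of \<open>p\<close>. So \<open>g\<close> lies in the closure of the conjugacy class
  of \<open>f\<close> as soon as \<open>f\<close> realises every graph of \<open>g\<close> (\<open>conj_class_closure_criterion\<close>).

  Two cases cover all \<open>f\<close>. If \<open>f ^^ n = id\<close> for some \<open>n \<ge> 1\<close>, then there are \<open>f\<close>-invariant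
  clopen partitions into any prescribed number of pieces; these realise the graphs of the
  identity, whose only edges are loops, so the identity is in the closure. Otherwise there is,
  for every \<open>L\<close>, a nonempty clopen \<open>U\<close> to which no point returns within \<open>L\<close> steps. A chain
  mixing map with a fixed point has strongly connected graphs with a loop; such a graph is
  traversed by a closed walk of some length \<open>L\<close> based at the loop. Points wait at the loop until
  they are fewer than \<open>L\<close> steps away from \<open>U\<close> and then follow the walk, arriving back exactly
  when they enter \<open>U\<close> (\<open>realize_closed_walk\<close>). Hence the closure contains the whole set \<open>CM1\<close>.

  Consequently a conjugacy minimal set contains the identity or all of \<open>CM1\<close>. Since \<open>CM1\<close> is
  closed and invariant, nonempty (it contains a copy of the one-sided full shift) and consists of
  non-periodic maps, both candidates are minimal and there are no others.
\<close>

section \<open>Every Cantor space is homeomorphic to the space of binary sequences\<close>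

abbreviation clopen_in :: "'a::topological_space set \<Rightarrow> 'a set \<Rightarrow> bool" where
  "clopen_in S C \<equiv> openin (top_of_set S) C \<and> closedin (top_of_set S) C"

lemma small_clopen_cover:
  fixes S :: "'a::metric_space set"
  assumes "compact S" "zero_dimensional S" "e > 0"
  shows "\<exists>F. finite F \<and> (\<forall>C\<in>F. clopen_in S C \<and> (\<forall>x\<in>C. \<forall>y\<in>C. dist x y < e)) \<and> \<Union>F = S"
proof -
  have "\<exists>C. clopen_in S C \<and> x \<in> C \<and> C \<subseteq> S \<inter> ball x (e/2)" if "x \<in> S" for x
  proof -
    have "openin (top_of_set S) (S \<inter> ball x (e/2))" by (simp add: openin_open_Int)
    moreover have "x \<in> S \<inter> ball x (e/2)" using that \<open>e > 0\<close> by simp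
    ultimately show ?thesis
      using \<open>zero_dimensional S\<close> unfolding zero_dimensional_def by meson
  qed
  then obtain C where C: "\<And>x. x \<in> S \<Longrightarrow> clopen_in S (C x) \<and> x \<in> C x \<and> C x \<subseteq> S \<inter> ball x (e/2)"
    by metis
  then have "\<forall>x\<in>S. \<exists>T. open T \<and> C x = S \<inter> T"
    using openin_open by metis
  then obtain T where T: "\<And>x. x \<in> S \<Longrightarrow> open (T x) \<and> C x = S \<inter> T x"
    by metis
  have "S \<subseteq> (\<Union>x\<in>S. T x)" using C T by blast
  then obtain S' where S': "S' \<subseteq> S" "finite S'" "S \<subseteq> (\<Union>x\<in>S'. T x)"
    using compactE_image[OF \<open>compact S\<close>, of S T] T by metis
  have "dist x y < e" if "z \<in> S'" "x \<in> C z" "y \<in> C z" for x y z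
  proof -
    have "dist z x < e/2" "dist z y < e/2"
      using C[of z] that S' mem_ball by blast+
    then show ?thesis by (metis dist_commute dist_triangle_half_r)
  qed
  moreover have "\<Union> (C ` S') = S" using S' C T by blast
  moreover have "clopen_in S (C z)" if "z \<in> S'" for z using that C S' by blast
  ultimately show ?thesis using S'(2) by (intro exI[of _ "C ` S'"]) simp
qed

text \<open>
  Covers by clopen sets of diameter below \<open>1 / (m + 1)\<close> can be chosen finite, so together they are
  only countably many; two distinct points are told apart once \<open>m\<close> is large.
\<close>

lemma countable_separating_clopens:
  fixes S :: "'a::metric_space set"
  assumes "compact S" "zero_dimensional S"
  obtains U where "\<And>n. clopen_in S (U n)"
    "\<And>x y. x \<in> S \<Longrightarrow> y \<in> S \<Longrightarrow> x \<noteq> y \<Longrightarrow> \<exists>n. x \<in> U n \<and> y \<notin> U (n::nat)"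
proof -
  have "\<forall>m::nat. \<exists>F. finite F \<and>
      (\<forall>C\<in>F. clopen_in S C \<and> (\<forall>x\<in>C. \<forall>y\<in>C. dist x y < inverse (real (Suc m)))) \<and> \<Union>F = S"
    by (intro allI small_clopen_cover[OF assms]) simp
  from choice[OF this] obtain F where "\<forall>m::nat. finite (F m) \<and>
      (\<forall>C\<in>F m. clopen_in S C \<and> (\<forall>x\<in>C. \<forall>y\<in>C. dist x y < inverse (real (Suc m)))) \<and> \<Union>(F m) = S" ..
  then have F: "\<And>m. finite (F m)" "\<And>m C. C \<in> F m \<Longrightarrow> clopen_in S C"
    "\<And>m C x y. C \<in> F m \<Longrightarrow> x \<in> C \<Longrightarrow> y \<in> C \<Longrightarrow> dist x y < inverse (real (Suc m))" "\<And>m. \<Union>(F m) = S"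
    by simp_all
  define B where "B = insert {} (\<Union>m. F m)"
  have "countable B" "B \<noteq> {}" unfolding B_def using F(1) by (auto simp: countable_finite)
  show thesis
  proof (rule that[of "from_nat_into B"])
    show "clopen_in S (from_nat_into B n)" for n
      using from_nat_into[OF \<open>B \<noteq> {}\<close>, of n] F(2) by (auto simp: B_def)
    fix x y assume "x \<in> S" "y \<in> S" "x \<noteq> y"
    then obtain m where m: "inverse (real (Suc m)) < dist x y"
      using reals_Archimedean[of "dist x y"] by auto
    obtain C where C: "C \<in> F m" "x \<in> C" using F(4)[of m] \<open>x \<in> S\<close> by blast
    then have "y \<notin> C" using F(3)[of C m x y] m by auto
    moreover have "C \<in> B" using C by (auto simp: B_def)
    ultimately show "\<exists>n. x \<in> from_nat_into B n \<and> y \<notin> from_nat_into B n"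
      using C from_nat_into_surj[OF \<open>countable B\<close>] by metis
  qed
qed

lemma clopen_in_Cantor_space:
  assumes "Cantor_space S" "clopen_in S C" "C \<noteq> {}"
  shows "Cantor_space C"
  unfolding Cantor_space_def
proof (intro conjI ballI)
  have S: "compact S" "zero_dimensional S" "\<And>x. x \<in> S \<Longrightarrow> x islimpt S"
    using assms(1) by (auto simp: Cantor_space_def)
  have "C \<subseteq> S" using assms(2) openin_imp_subset by blast
  show "C \<noteq> {}" by fact
  show "compact C" using S(1) assms(2) closedin_compact by blast
  show "zero_dimensional C"
    unfolding zero_dimensional_def
  proof (intro allI impI ballI)
    fix U x assume U: "openin (top_of_set C) U" "x \<in> U"
    then have "openin (top_of_set S) U" using assms(2) openin_trans by blast
    then obtain D where D: "clopen_in S D" "x \<in> D" "D \<subseteq> U"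
      using S(2) U unfolding zero_dimensional_def by metis
    then have "D \<subseteq> C" using U openin_imp_subset by blast
    then have "clopen_in C D"
      using D \<open>C \<subseteq> S\<close> openin_subset_trans closedin_subset_trans by blast
    then show "\<exists>D. openin (top_of_set C) D \<and> closedin (top_of_set C) D \<and> x \<in> D \<and> D \<subseteq> U"
      using D by blast
  qed
  fix x assume "x \<in> C"
  obtain T where T: "open T" "C = S \<inter> T" using assms(2) openin_open by metis
  show "x islimpt C"
    unfolding T(2)
    by (rule islimpt_Int_eventually) (use S(3)[of x] T \<open>x \<in> C\<close> in \<open>auto simp: eventually_at_topological\<close>)
qed

lemma Cantor_space_split:
  fixes S :: "'a::metric_space set"
  assumes "Cantor_space S"
  obtains D where "clopen_in S D" "D \<noteq> {}" "S - D \<noteq> {}"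
proof -
  obtain x where x: "x \<in> S" using assms by (auto simp: Cantor_space_def)
  then have "x islimpt S" using assms by (auto simp: Cantor_space_def)
  then obtain y where y: "y \<in> S" "y \<noteq> x" by (metis islimptE open_UNIV UNIV_I)
  have "openin (top_of_set S) (S \<inter> (- {y}))" by (intro openin_open_Int) (simp add: open_Compl)
  moreover have "x \<in> S \<inter> (- {y})" using x y by simp
  moreover have "zero_dimensional S" using assms by (simp add: Cantor_space_def)
  ultimately obtain D where "clopen_in S D" "x \<in> D" "D \<subseteq> S \<inter> (- {y})"
    unfolding zero_dimensional_def by meson
  then show thesis using that[of D] y by blast
qed

text \<open>
  A Cantor scheme: \<open>D n C\<close> is the part that is cut off from a cell \<open>C\<close> at depth \<open>n\<close>. Cells are
  indexed by the binary decisions made so far, the most recent one first, so that prolonging a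
  branch is a cons.
\<close>

primrec cell :: "(nat \<Rightarrow> 'a set \<Rightarrow> 'a set) \<Rightarrow> 'a set \<Rightarrow> bool list \<Rightarrow> 'a set" where
  "cell D S [] = S"
| "cell D S (b # s) =
    (if b then D (length s) (cell D S s) else cell D S s - D (length s) (cell D S s))"

primrec address :: "(nat \<Rightarrow> 'a set \<Rightarrow> 'a set) \<Rightarrow> 'a set \<Rightarrow> 'a \<Rightarrow> nat \<Rightarrow> bool list" where
  "address D S x 0 = []"
| "address D S x (Suc n) = (x \<in> D n (cell D S (address D S x n))) # address D S x n"

lemma length_address [simp]: "length (address D S x n) = n"
  by (induction n) auto

lemma mem_cell_address: "x \<in> S \<Longrightarrow> x \<in> cell D S (address D S x n)"
  by (induction n) auto

text \<open>
  Cells of equal depth are pairwise disjoint.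
\<close>

lemma address_unique:
  assumes "\<And>s. D (length s) (cell D S s) \<subseteq> cell D S s" "x \<in> cell D S s"
  shows "address D S x (length s) = s"
  using assms(2)
proof (induction s)
  case (Cons b s)
  then have "x \<in> cell D S s" using assms(1)[of s] by (auto split: if_splits)
  then show ?case using Cons by (auto split: if_splits)
qed simp

lemma continuous_on_if_locally_constant:
  assumes "\<And>x. x \<in> S \<Longrightarrow> \<exists>U. openin (top_of_set S) U \<and> x \<in> U \<and> (\<forall>y\<in>U. f y = f x)"
  shows "continuous_on S f"
  unfolding continuous_on_def
proof
  fix x assume "x \<in> S"
  then obtain U where U: "openin (top_of_set S) U" "x \<in> U" "\<forall>y\<in>U. f y = f x" using assms by blast
  then obtain T where "open T" "U = S \<inter> T" by (auto simp: openin_open)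
  then have "eventually (\<lambda>y. f y = f x) (at x within S)"
    using U unfolding eventually_at_topological by blast
  then show "(f \<longlongrightarrow> f x) (at x within S)" by (rule tendsto_eventually)
qed

lemma Hausdorff_space_binary_sequences: "Hausdorff_space (euclidean :: (nat \<Rightarrow> bool) topology)"
proof -
  have "\<exists>U V. open U \<and> open V \<and> x \<in> U \<and> y \<in> V \<and> U \<inter> V = {}" if "x \<noteq> y" for x y :: "nat \<Rightarrow> bool"
  proof -
    have "\<exists>i. x i \<noteq> y i" using that by (simp add: fun_eq_iff)
    then obtain i where i: "x i \<noteq> y i" ..
    have "open ((\<lambda>z. z i) -` W)" for W :: "bool set"
      by (intro open_vimage continuous_on_product_coordinates open_discrete)
    with i show ?thesis
      by (intro exI[of _ "(\<lambda>z. z i) -` {x i}"] exI[of _ "(\<lambda>z. z i) -` {y i}"]) auto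
  qed
  then show ?thesis by (simp add: Hausdorff_space_def disjnt_def)
qed

text \<open>
  Brouwer's characterisation. The scheme cuts a cell of depth \<open>n\<close> along the \<open>n\<close>-th member of a
  countable separating family of clopen sets whenever this is a proper cut, and along an arbitrary
  proper clopen subset otherwise. All cells are then nonempty, so by compactness every infinite branch
  contains a point, while the separating family leaves it no second one.
\<close>

theorem Cantor_space_homeomorphic_binary_sequences:
  fixes S :: "'a::metric_space set"
  assumes "Cantor_space S"
  shows "S homeomorphic (UNIV :: (nat \<Rightarrow> bool) set)"
proof -
  have S: "compact S" "zero_dimensional S" using assms by (auto simp: Cantor_space_def)
  obtain U where U: "\<And>n. clopen_in S (U n)"
    "\<And>x y. x \<in> S \<Longrightarrow> y \<in> S \<Longrightarrow> x \<noteq> y \<Longrightarrow> \<exists>n. x \<in> U n \<and> y \<notin> U (n::nat)"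
    using countable_separating_clopens[OF S] by metis
  have "\<exists>D. clopen_in S D \<and> D \<subseteq> C \<and> D \<noteq> {} \<and> C - D \<noteq> {} \<and>
      (C \<inter> U n \<noteq> {} \<longrightarrow> C - U n \<noteq> {} \<longrightarrow> D = C \<inter> U n)"
    if C: "clopen_in S C" "C \<noteq> {}" for n C
  proof (cases "C \<inter> U n \<noteq> {} \<and> C - U n \<noteq> {}")
    case True
    then show ?thesis using C U(1)[of n] by (intro exI[of _ "C \<inter> U n"]) auto
  next
    case False
    obtain D where D: "clopen_in C D" "D \<noteq> {}" "C - D \<noteq> {}"
      using Cantor_space_split[OF clopen_in_Cantor_space[OF assms C]] by metis
    then have "D \<subseteq> C" using openin_imp_subset by blast
    moreover have "clopen_in S D" using D(1) C(1) openin_trans closedin_trans by blast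
    ultimately show ?thesis using False D by blast
  qed
  note proper_cut = this
  define D where "D n C = (SOME D. clopen_in S D \<and> D \<subseteq> C \<and> D \<noteq> {} \<and> C - D \<noteq> {} \<and>
      (C \<inter> U n \<noteq> {} \<longrightarrow> C - U n \<noteq> {} \<longrightarrow> D = C \<inter> U n))" for n C
  have D: "clopen_in S (D n C) \<and> D n C \<subseteq> C \<and> D n C \<noteq> {} \<and> C - D n C \<noteq> {} \<and>
      (C \<inter> U n \<noteq> {} \<longrightarrow> C - U n \<noteq> {} \<longrightarrow> D n C = C \<inter> U n)"
    if "clopen_in S C" "C \<noteq> {}" for n C
    unfolding D_def by (rule someI_ex) (rule proper_cut[OF that])
  let ?cell = "cell D S" and ?address = "address D S"
  have cell: "clopen_in S (?cell s) \<and> ?cell s \<noteq> {}" for s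
  proof (induction s)
    case Nil
    then show ?case using assms by (auto simp: Cantor_space_def)
  next
    case (Cons b s)
    then show ?case using D[of "?cell s" "length s"] by (auto intro: openin_diff closedin_diff)
  qed
  have sub: "D (length s) (?cell s) \<subseteq> ?cell s" for s
    using D[of "?cell s" "length s"] cell[of s] by simp
  define \<phi> where "\<phi> x n = (x \<in> D n (?cell (?address x n)))" for x n
  have cont: "continuous_on S \<phi>"
  proof (intro continuous_on_coordinatewise_then_product continuous_on_if_locally_constant)
    fix n x assume x: "x \<in> S"
    have "\<phi> y n = \<phi> x n" if "y \<in> ?cell (?address x (Suc n))" for y
    proof -
      have "?address y (Suc n) = ?address x (Suc n)"
        using address_unique[OF sub that] by (simp only: length_address)
      then show ?thesis by (simp add: \<phi>_def del: cell.simps) metis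
    qed
    then show "\<exists>V. openin (top_of_set S) V \<and> x \<in> V \<and> (\<forall>y\<in>V. \<phi> y n = \<phi> x n)"
      using cell[of "?address x (Suc n)"] mem_cell_address[OF x, of D "Suc n"]
      by (intro exI[of _ "?cell (?address x (Suc n))"]) blast
  qed
  have surj: "\<phi> ` S = UNIV"
  proof (intro equalityI subset_UNIV subsetI)
    fix b :: "nat \<Rightarrow> bool"
    define s where "s n = rev (map b [0..<n])" for n
    have s_Suc: "s (Suc n) = b n # s n" and len: "length (s n) = n" for n by (auto simp: s_def)
    have dec: "?cell (s (Suc n)) \<subseteq> ?cell (s n)" for n
      using sub[of "s n"] by (auto simp: s_Suc)
    have anti: "?cell (s n) \<subseteq> ?cell (s m)" if "m \<le> n" for m n
      by (rule lift_Suc_antimono_le[of "\<lambda>n. ?cell (s n)", OF dec that])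
    have "S \<inter> (\<Inter>n\<in>UNIV. ?cell (s n)) \<noteq> {}"
    proof (rule compact_imp_fip_image[OF S(1)])
      show "closed (?cell (s n))" for n
        using cell S(1) closedin_compact compact_imp_closed by blast
      fix I :: "nat set" assume "finite I"
      then obtain m where "\<forall>i\<in>I. i \<le> m" using finite_nat_set_iff_bounded_le by blast
      then have "?cell (s m) \<subseteq> S \<inter> (\<Inter>n\<in>I. ?cell (s n))"
        using anti cell openin_imp_subset by blast
      then show "S \<inter> (\<Inter>n\<in>I. ?cell (s n)) \<noteq> {}" using cell[of "s m"] by blast
    qed
    then obtain z where z: "z \<in> S" "\<And>n. z \<in> ?cell (s n)" by blast
    have "?address z n = s n" for n using address_unique[OF sub z(2)[of n]] by (simp add: len)
    then have "\<phi> z n = b n" for n using s_Suc[of n] by (metis \<phi>_def address.simps(2) list.inject)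
    then show "b \<in> \<phi> ` S" using z(1) by blast
  qed
  have inj: "inj_on \<phi> S"
  proof (rule inj_onI, rule ccontr)
    fix x y assume xy: "x \<in> S" "y \<in> S" "\<phi> x = \<phi> y" "x \<noteq> y"
    have same: "?address x n = ?address y n" for n
    proof (induction n)
      case (Suc n)
      then show ?case using fun_cong[OF xy(3), of n] by (simp add: \<phi>_def)
    qed simp
    obtain n where n: "x \<in> U n" "y \<notin> U n" using U(2) xy by blast
    let ?C = "?cell (?address x n)"
    have "x \<in> ?C" "y \<in> ?C" using mem_cell_address xy same by metis+
    then have "D n ?C = ?C \<inter> U n" using D[of ?C n] cell n by blast
    then have "\<phi> x n \<noteq> \<phi> y n" using n \<open>x \<in> ?C\<close> same by (simp add: \<phi>_def)
    then show False using xy(3) by simp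
  qed
  have "homeomorphic_map (top_of_set S) euclidean \<phi>"
    using continuous_imp_homeomorphic_map[of "top_of_set S" euclidean \<phi>]
      cont surj inj S(1) Hausdorff_space_binary_sequences
    by (simp add: compact_space_subtopology)
  then obtain \<psi> where \<psi>: "homeomorphic_maps (top_of_set S) euclidean \<phi> \<psi>"
    by (auto simp: homeomorphic_map_maps)
  have "homeomorphism S UNIV \<phi> \<psi>"
  proof (rule homeomorphismI)
    show "continuous_on UNIV \<psi>" and "\<psi> ` UNIV \<subseteq> S"
      using \<psi> by (auto simp: homeomorphic_maps_def continuous_map_in_subtopology)
    show "\<psi> (\<phi> x) = x" if "x \<in> S" for x
      using \<psi> that by (simp add: homeomorphic_maps_def)
    show "\<phi> (\<psi> y) = y" for y
      using \<psi> by (simp add: homeomorphic_maps_def)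
  qed (use cont in auto)
  then show ?thesis by (auto simp: homeomorphic_def)
qed

section \<open>Locally constant maps\<close>

text \<open>
  The values of such a map are names for the pieces of an open (hence clopen) partition. Stating it
  with neighbourhood filters makes finite combinations of such maps a matter of conjunction.
\<close>

definition locally_constant :: "('a::topological_space \<Rightarrow> 'b) \<Rightarrow> bool" where
  "locally_constant p \<longleftrightarrow> (\<forall>x. eventually (\<lambda>y. p y = p x) (nhds x))"

text \<open>
  The workhorse for checking that a code built from finitely many earlier codes is again a code.
\<close>

lemma locally_constant_finite_dependence:
  assumes "finite I" "\<And>i. i \<in> I \<Longrightarrow> locally_constant (p i)"
    and "\<And>x y. (\<And>i. i \<in> I \<Longrightarrow> p i y = p i x) \<Longrightarrow> q y = q x"
  shows "locally_constant q"
  unfolding locally_constant_def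
proof
  fix x
  have "\<forall>\<^sub>F y in nhds x. \<forall>i\<in>I. p i y = p i x"
    using assms(1,2) by (simp add: eventually_ball_finite locally_constant_def)
  then show "\<forall>\<^sub>F y in nhds x. q y = q x"
    by (rule eventually_mono) (use assms(3) in blast)
qed

lemma locally_constant_Pair:
  assumes "locally_constant p" "locally_constant q"
  shows "locally_constant (\<lambda>x. (p x, q x))"
  using assms unfolding locally_constant_def by (simp add: eventually_conj_iff)

lemma locally_constant_compose_continuous:
  assumes "locally_constant p" "continuous_on UNIV f"
  shows "locally_constant (\<lambda>x. p (f x))"
  unfolding locally_constant_def
proof
  fix x
  have "filterlim f (nhds (f x)) (nhds x)"
    using assms(2) by (simp add: continuous_on_def tendsto_at_iff_tendsto_nhds[symmetric])
  moreover have "eventually (\<lambda>z. p z = p (f x)) (nhds (f x))"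
    using assms(1) unfolding locally_constant_def by blast
  ultimately show "eventually (\<lambda>y. p (f y) = p (f x)) (nhds x)"
    by (rule eventually_compose_filterlim[rotated])
qed

lemma locally_constant_fibre:
  assumes "locally_constant p"
  shows "open {x. p x = a}" "closed {x. p x = a}"
proof -
  have *: "open {x. p x \<in> B}" for B
  proof (rule open_subopen[THEN iffD2], intro ballI)
    fix x assume x: "x \<in> {x. p x \<in> B}"
    have "\<forall>\<^sub>F y in nhds x. p y = p x" using assms by (simp only: locally_constant_def)
    then obtain T where "open T \<and> x \<in> T \<and> (\<forall>y\<in>T. p y = p x)" unfolding eventually_nhds ..
    then have T: "open T" "x \<in> T" "\<forall>y\<in>T. p y = p x" by iprover+
    have "p y \<in> B" if "y \<in> T" for y using bspec[OF T(3) that] x by simp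
    then have "T \<subseteq> {x. p x \<in> B}" by blast
    with T(1,2) show "\<exists>T. open T \<and> x \<in> T \<and> T \<subseteq> {x. p x \<in> B}" by blast
  qed
  show "open {x. p x = a}" using *[of "{a}"] by simp
  show "closed {x. p x = a}"
  proof -
    have "- {x. p x = a} = {x. p x \<in> - {a}}" by blast
    then show ?thesis using *[of "- {a}"] by (simp only: closed_def)
  qed
qed

lemma locally_constant_uniform:
  fixes p :: "'a::metric_space \<Rightarrow> 'b"
  assumes "compact (UNIV :: 'a set)" "locally_constant p"
  obtains d where "d > 0" "\<And>x y. dist x y < d \<Longrightarrow> p x = p y"
proof -
  obtain d where d: "d > 0" "\<And>x. \<exists>G\<in>range (\<lambda>a. {x. p x = a}). ball x d \<subseteq> G"
    by (rule Heine_Borel_lemma[OF assms(1), of "range (\<lambda>a. {x. p x = a})"])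
       (use locally_constant_fibre(1)[OF assms(2)] in auto)
  have "p x = p y" if "dist x y < d" for x y
  proof -
    obtain a where "ball x d \<subseteq> {x. p x = a}" using d(2)[of x] by auto
    moreover have "x \<in> ball x d" "y \<in> ball x d" using d(1) that by auto
    ultimately show ?thesis by blast
  qed
  then show thesis using that d(1) by blast
qed

lemma locally_constant_finite_range:
  fixes p :: "'a::topological_space \<Rightarrow> 'b"
  assumes "compact (UNIV :: 'a set)" "locally_constant p"
  shows "finite (range p)"
proof -
  obtain C where "C \<subseteq> range p" "finite C" "UNIV \<subseteq> (\<Union>a\<in>C. {x. p x = a})"
    by (rule compactE_image[OF assms(1), of "range p" "\<lambda>a. {x. p x = a}"])
       (use locally_constant_fibre(1)[OF assms(2)] in auto)
  then have "range p \<subseteq> C" by auto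
  then show ?thesis using \<open>finite C\<close> finite_subset by blast
qed

text \<open>
  Given a finite cover by small clopen sets, a point is named by the set of members containing it.
\<close>

lemma fine_locally_constant:
  fixes e :: real
  assumes "Cantor_space (UNIV :: 'a::metric_space set)" "e > 0"
  obtains p :: "'a::metric_space \<Rightarrow> 'a set set" where "locally_constant p" "\<And>x y. p x = p y \<Longrightarrow> dist x y < e"
proof -
  have "compact (UNIV :: 'a set)" "zero_dimensional (UNIV :: 'a set)"
    using assms(1) by (simp_all add: Cantor_space_def)
  from small_clopen_cover[OF this assms(2)] obtain F where "finite F \<and>
      (\<forall>C\<in>F. clopen_in UNIV C \<and> (\<forall>x\<in>C. \<forall>y\<in>C. dist x y < e)) \<and> \<Union>F = (UNIV :: 'a set)" ..
  then have F: "finite F"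
      "\<And>C. C \<in> F \<Longrightarrow> clopen_in UNIV C \<and> (\<forall>x\<in>C. \<forall>y\<in>C. dist x y < e)" "\<Union>F = (UNIV :: 'a set)"
    by simp_all
  have "locally_constant (\<lambda>x. x \<in> C)" if "C \<in> F" for C
    unfolding locally_constant_def
  proof
    fix x
    have "open C" "open (- C)" using F(2)[OF that] by auto
    then show "\<forall>\<^sub>F y in nhds x. (y \<in> C) = (x \<in> C)"
      using eventually_nhds_in_open[of C x] eventually_nhds_in_open[of "- C" x]
      by (cases "x \<in> C") auto
  qed
  then have "locally_constant (\<lambda>x. {C \<in> F. x \<in> C})"
  proof (rule locally_constant_finite_dependence[OF F(1), of "\<lambda>C x. x \<in> C"])
    show "{C \<in> F. y \<in> C} = {C \<in> F. x \<in> C}" if "\<And>C. C \<in> F \<Longrightarrow> (y \<in> C) = (x \<in> C)" for x y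
      by (rule Collect_cong) (metis that)
  qed
  moreover have "dist x y < e" if "{C \<in> F. x \<in> C} = {C \<in> F. y \<in> C}" for x y
  proof -
    have "x \<in> \<Union>F" using F(3) by simp
    then obtain C where C: "C \<in> F" "x \<in> C" ..
    then have "C \<in> {C \<in> F. x \<in> C}" by simp
    then have "y \<in> C" unfolding that by simp
    then show ?thesis using C F(2)[of C] by blast
  qed
  ultimately show thesis by (rule that)
qed

section \<open>Conjugation\<close>

lemma homeo_groupD:
  assumes "h \<in> homeo_group"
  shows "continuous_on UNIV h" "continuous_on UNIV (inv h)" "inv h (h x) = x" "h (inv h y) = y"
  using assms by (auto simp: homeo_group_def homeomorphism_def)

text \<open>
  Every fibre of a code is a nonempty clopen set, hence itself a Cantor space, so fibres over
  the same name are homeomorphic; being open, they can be glued.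
\<close>

lemma homeo_group_matching_codes:
  fixes p q :: "'a::metric_space \<Rightarrow> 'b"
  assumes X: "Cantor_space (UNIV :: 'a set)"
    and lc: "locally_constant p" "locally_constant q" and range: "range p = range q"
  obtains h where "h \<in> homeo_group" "\<And>x. p (h x) = q x"
proof -
  have Cantor: "Cantor_space {x. r x = a}" if "locally_constant r" "a \<in> range r"
    for r :: "'a \<Rightarrow> 'b" and a
    using that by (intro clopen_in_Cantor_space[OF X]) (auto simp: locally_constant_fibre)
  have "\<exists>h g. homeomorphism {x. q x = a} {x. p x = a} h g" if "a \<in> range q" for a
  proof -
    have "{x. q x = a} homeomorphic {x. p x = a}"
      using Cantor_space_homeomorphic_binary_sequences[OF Cantor[OF lc(2) that]]
        Cantor_space_homeomorphic_binary_sequences[OF Cantor[OF lc(1)], of a] that range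
      by (metis homeomorphic_sym homeomorphic_trans)
    then show ?thesis by (simp add: homeomorphic_def)
  qed
  then obtain h g where hg: "\<And>a. a \<in> range q \<Longrightarrow> homeomorphism {x. q x = a} {x. p x = a} (h a) (g a)"
    by metis
  define H where "H x = h (q x) x" for x
  define G where "G y = g (p y) y" for y
  have pH: "p (H x) = q x" for x
    using hg[of "q x"] by (auto simp: H_def homeomorphism_def)
  have qG: "q (G y) = p y" for y
    using hg[of "p y"] range by (auto simp: G_def homeomorphism_def)
  have GH: "G (H x) = x" for x
    using hg[of "q x"] pH[of x] by (auto simp: G_def H_def homeomorphism_def)
  have HG: "H (G y) = y" for y
    using hg[of "p y"] qG[of y] range by (auto simp: G_def H_def homeomorphism_def)
  have glue: "continuous_on UNIV (\<lambda>x. k (r x) x)"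
    if "locally_constant r" "\<And>a. continuous_on {x. r x = a} (k a)" for r :: "'a \<Rightarrow> 'b" and k :: "'b \<Rightarrow> 'a \<Rightarrow> 'a"
  proof -
    have "continuous_on (\<Union>(range (\<lambda>a. {x. r x = a}))) (\<lambda>x. k (r x) x)"
    proof (rule continuous_on_open_Union)
      fix S assume "S \<in> range (\<lambda>a. {x. r x = a})"
      then obtain a where S: "S = {x. r x = a}" by blast
      show "open S" using S locally_constant_fibre(1)[OF that(1)] by simp
      have "continuous_on {x. r x = a} (\<lambda>x. k (r x) x) = continuous_on {x. r x = a} (k a)"
        by (rule continuous_on_cong) auto
      then show "continuous_on S (\<lambda>x. k (r x) x)" using S that(2) by simp
    qed
    moreover have "\<Union>(range (\<lambda>a. {x. r x = a})) = UNIV" by auto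
    ultimately show ?thesis by simp
  qed
  have "continuous_on {x. q x = a} (h a)" for a
  proof (cases "a \<in> range q")
    case False
    then have "{x. q x = a} = {}" by blast
    then show ?thesis by simp
  qed (use hg in \<open>auto simp: homeomorphism_def\<close>)
  then have cH: "continuous_on UNIV H" unfolding H_def by (rule glue[OF lc(2)])
  have "continuous_on {x. p x = a} (g a)" for a
  proof (cases "a \<in> range q")
    case False
    then have "{x. p x = a} = {}" using range by blast
    then show ?thesis by simp
  qed (use hg in \<open>auto simp: homeomorphism_def\<close>)
  then have cG: "continuous_on UNIV G" unfolding G_def by (rule glue[OF lc(1)])
  have "inv H = G" using GH HG by (rule inv_equality)
  moreover have "homeomorphism UNIV UNIV H G"
    by (rule homeomorphismI) (use cH cG GH HG in auto)
  ultimately have "H \<in> homeo_group" by (simp add: homeo_group_def)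
  then show thesis using pH by (rule that)
qed

lemma conj_class_obtain:
  fixes f :: "'a::metric_space \<Rightarrow>\<^sub>C 'a"
  assumes "compact (UNIV :: 'a set)" "h \<in> homeo_group"
  obtains f' where "f' \<in> conj_class f" "\<And>x. apply_bcontfun f' (h x) = h (apply_bcontfun f x)"
proof -
  let ?k = "h \<circ> apply_bcontfun f \<circ> inv h"
  have "continuous_on UNIV ?k"
    by (intro continuous_on_compose continuous_on_subset[OF homeo_groupD(1)[OF assms(2)]]
          homeo_groupD(2)[OF assms(2)]) auto
  moreover have "bounded (range ?k)"
    using compact_imp_bounded[OF assms(1)] bounded_subset by blast
  ultimately have k: "apply_bcontfun (Bcontfun ?k) = ?k"
    by (intro Bcontfun_inverse) (simp add: bcontfun_def)
  show thesis
  proof (rule that)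
    show "Bcontfun ?k \<in> conj_class f" using k assms(2) by (auto simp: conj_class_def)
    show "apply_bcontfun (Bcontfun ?k) (h x) = h (apply_bcontfun f x)" for x
      using k homeo_groupD(3)[OF assms(2)] by simp
  qed
qed

lemma conj_classD:
  assumes "g \<in> conj_class f"
  shows "\<exists>h\<in>homeo_group. \<forall>x. apply_bcontfun g (h x) = h (apply_bcontfun f x)"
proof -
  obtain h where "h \<in> homeo_group" "apply_bcontfun g = h \<circ> apply_bcontfun f \<circ> inv h"
    using assms by (auto simp: conj_class_def)
  then show ?thesis by (intro bexI[of _ h]) (simp_all add: homeo_groupD)
qed

lemma conj_class_subset_cont_surj:
  assumes "f \<in> cont_surj"
  shows "conj_class f \<subseteq> cont_surj"
proof
  fix g assume "g \<in> conj_class f"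
  then obtain h where h: "h \<in> homeo_group" "\<forall>x. apply_bcontfun g (h x) = h (apply_bcontfun f x)"
    using conj_classD by metis
  have "y \<in> range (apply_bcontfun g)" for y
  proof -
    obtain x where "inv h y = apply_bcontfun f x"
      using assms surjD[of "apply_bcontfun f" "inv h y"] by (auto simp: cont_surj_def)
    then have "apply_bcontfun g (h x) = y" using h(2) homeo_groupD(4)[OF h(1), of y] by simp
    then show ?thesis by blast
  qed
  then show "g \<in> cont_surj" by (auto simp: cont_surj_def)
qed

lemma conj_class_id_map:
  assumes "compact (UNIV :: 'a::metric_space set)"
  shows "conj_class (id_map :: 'a::metric_space \<Rightarrow>\<^sub>C 'a) = {id_map}"
proof -
  have "h \<circ> apply_bcontfun id_map \<circ> inv h = (apply_bcontfun id_map :: 'a \<Rightarrow> 'a)"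
    if "h \<in> homeo_group" for h
    using homeo_groupD(4)[OF that] by (auto simp: apply_id_map[OF assms])
  moreover have "id \<in> (homeo_group :: ('a \<Rightarrow> 'a) set)"
    by (auto simp: homeo_group_def homeomorphism_def)
  ultimately show ?thesis by (auto simp: conj_class_def apply_bcontfun_inject)
qed

lemma closure_of_cont_surj_iff:
  "g \<in> top_of_set cont_surj closure_of A \<longleftrightarrow>
     g \<in> cont_surj \<and> (\<forall>e>0. \<exists>a \<in> cont_surj \<inter> A. dist a g < e)"
  by (simp add: closure_of_subtopology closure_approachable)

text \<open>
  Matching the edge \<open>(q x, q (f x))\<close> of \<open>x\<close> with the edge of \<open>h x\<close> under \<open>p\<close> and \<open>g\<close> gives, for
  \<open>y = h x\<close>, that \<open>p (h (f x)) = q (f x) = p (g y)\<close>: the conjugate of \<open>f\<close> and \<open>g\<close> move \<open>y\<close> into the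
  same small cell of \<open>p\<close>.
\<close>

lemma conj_class_closure_criterion:
  fixes f g :: "'a::metric_space \<Rightarrow>\<^sub>C 'a"
  assumes X: "Cantor_space (UNIV :: 'a set)" and fg: "f \<in> cont_surj" "g \<in> cont_surj"
    and realize: "\<And>p :: 'a \<Rightarrow> 'a set set. locally_constant p \<Longrightarrow>
      \<exists>q :: 'a \<Rightarrow> 'a set set. locally_constant q \<and>
        range (\<lambda>x. (q x, q (apply_bcontfun f x))) = range (\<lambda>x. (p x, p (apply_bcontfun g x)))"
  shows "g \<in> top_of_set cont_surj closure_of conj_class f"
  unfolding closure_of_cont_surj_iff
proof (intro conjI allI impI)
  fix e :: real assume "e > 0"
  have "compact (UNIV :: 'a set)" using X by (simp add: Cantor_space_def)
  obtain p :: "'a \<Rightarrow> 'a set set" where p: "locally_constant p" "\<And>x y. p x = p y \<Longrightarrow> dist x y < e/2"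
    using fine_locally_constant[OF X, of "e/2"] \<open>e > 0\<close> by auto
  obtain q :: "'a \<Rightarrow> 'a set set" where q: "locally_constant q"
    "range (\<lambda>x. (q x, q (apply_bcontfun f x))) = range (\<lambda>x. (p x, p (apply_bcontfun g x)))"
    using realize[OF p(1)] by blast
  have lc: "locally_constant (\<lambda>x. (p x, p (apply_bcontfun g x)))"
    "locally_constant (\<lambda>x. (q x, q (apply_bcontfun f x)))"
    by (intro locally_constant_Pair p(1) q(1) locally_constant_compose_continuous
          continuous_on_apply_bcontfun)+
  obtain h where h: "h \<in> homeo_group"
    "\<And>x. (p (h x), p (apply_bcontfun g (h x))) = (q x, q (apply_bcontfun f x))"
    using homeo_group_matching_codes[OF X lc q(2)[symmetric]] by metis
  obtain f' where f': "f' \<in> conj_class f" "\<And>x. apply_bcontfun f' (h x) = h (apply_bcontfun f x)"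
    using conj_class_obtain[OF \<open>compact UNIV\<close> h(1)] by metis
  have "dist (apply_bcontfun f' y) (apply_bcontfun g y) \<le> e/2" for y
  proof -
    obtain x where y: "y = h x" using homeo_groupD(4)[OF h(1)] by metis
    have "p (apply_bcontfun f' y) = p (apply_bcontfun g y)"
      using f'(2)[of x] h(2)[of x] h(2)[of "apply_bcontfun f x"] y by simp
    then show ?thesis using p(2) less_imp_le by blast
  qed
  then have "dist f' g \<le> e/2" by (rule dist_bound)
  then show "\<exists>a\<in>cont_surj \<inter> conj_class f. dist a g < e"
    using f'(1) conj_class_subset_cont_surj[OF fg(1)] \<open>e > 0\<close> by force
qed (rule fg)

section \<open>Walks and their realisation by a non-periodic map\<close>

text \<open>
  A walk of length \<open>n\<close> is a function on \<open>nat\<close> of which only the values at \<open>0, \<dots>, n\<close> matter.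
\<close>

definition edges :: "(nat \<Rightarrow> 'b) \<Rightarrow> nat \<Rightarrow> ('b \<times> 'b) set" where
  "edges v n = (\<lambda>i. (v i, v (Suc i))) ` {..<n}"

lemma concat_walks:
  assumes "u m = v 0"
  obtains w where "w 0 = u 0" "w (m + n) = v n" "edges w (m + n) = edges u m \<union> edges v n"
proof
  define w where "w i = (if i \<le> m then u i else v (i - m))" for i
  have shift: "w (m + i) = v i" for i using assms(1) by (simp add: w_def)
  show "w 0 = u 0" by (simp add: w_def)
  show "w (m + n) = v n" by (rule shift)
  have "{..<m + n} = {..<m} \<union> (+) m ` {..<n}"
    unfolding image_add_atLeastLessThan lessThan_atLeast0 by (auto simp: ivl_disj_un)
  then have "edges w (m + n) = (\<lambda>i. (w i, w (Suc i))) ` {..<m} \<union> (\<lambda>i. (w (m + i), w (m + Suc i))) ` {..<n}"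
    by (simp add: edges_def image_Un image_image)
  also have "(\<lambda>i. (w i, w (Suc i))) ` {..<m} = edges u m"
    unfolding edges_def by (rule image_cong) (auto simp: w_def)
  finally show "edges w (m + n) = edges u m \<union> edges v n" by (simp only: shift edges_def)
qed

lemma rtrancl_walk:
  assumes "(a, b) \<in> R\<^sup>*"
  obtains v n where "v 0 = a" "v n = b" "edges v n \<subseteq> R"
proof -
  obtain n v where "v 0 = a" "v n = b" "\<forall>i<n. (v i, v (Suc i)) \<in> R"
    using assms by (auto simp: rtrancl_power relpow_fun_conv)
  then show thesis by (intro that[of v n]) (auto simp: edges_def)
qed

text \<open>
  Each edge is visited by a detour: from the base point to its source, along it, and back.
\<close>

lemma closed_walk_through_all_edges:
  assumes "finite E" "E \<subseteq> R" "\<And>a b. (a, b) \<in> E \<Longrightarrow> (c, a) \<in> R\<^sup>* \<and> (b, c) \<in> R\<^sup>*"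
  shows "\<exists>v n. v 0 = c \<and> v n = c \<and> edges v n \<subseteq> R \<and> E \<subseteq> edges v n"
  using assms
proof (induction E)
  case empty
  show ?case by (intro exI[of _ "\<lambda>_. c"] exI[of _ 0]) (simp add: edges_def)
next
  case (insert e E)
  obtain v n where v: "v 0 = c" "v n = c" "edges v n \<subseteq> R" "E \<subseteq> edges v n"
    using insert.IH insert.prems by (metis insert_iff insert_subset)
  obtain a b where e: "e = (a, b)" by (cases e)
  have "(c, a) \<in> R\<^sup>*" "(b, c) \<in> R\<^sup>*" using insert.prems(2)[of a b] e by auto
  then obtain u k w l where u: "u 0 = c" "u k = a" "edges u k \<subseteq> R"
    and w: "w 0 = b" "w l = c" "edges w l \<subseteq> R"
    by (metis rtrancl_walk)
  define s where "s = (\<lambda>i::nat. if i = 0 then a else b)"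
  have s: "s 0 = a" "s 1 = b" "edges s 1 = {e}" by (auto simp: s_def edges_def e)
  obtain x where x: "x 0 = v 0" "x (n + k) = u k" "edges x (n + k) = edges v n \<union> edges u k"
    by (rule concat_walks[of v n u k]) (use v u in simp)
  obtain y where y: "y 0 = x 0" "y (n + k + 1) = s 1" "edges y (n + k + 1) = edges x (n + k) \<union> edges s 1"
    by (rule concat_walks[of x "n + k" s 1]) (use x u s in simp)
  obtain z where z: "z 0 = y 0" "z (n + k + 1 + l) = w l"
      "edges z (n + k + 1 + l) = edges y (n + k + 1) \<union> edges w l"
    by (rule concat_walks[of y "n + k + 1" w l]) (use y w s in simp)
  have "z 0 = c" "z (n + k + 1 + l) = c" using x y z v w by simp_all
  moreover have "edges z (n + k + 1 + l) = edges v n \<union> edges u k \<union> {e} \<union> edges w l"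
    using x(3) y(3) z(3) s(3) by simp
  ultimately show ?case
    using v u w insert.prems(1) by (intro exI[of _ z] exI[of _ "n + k + 1 + l"]) auto
qed

lemma locally_constant_funpow:
  fixes f :: "'a::topological_space \<Rightarrow> 'a"
  assumes "locally_constant p" "continuous_on UNIV f"
  shows "locally_constant (\<lambda>x. p ((f ^^ i) x))"
proof (induction i)
  case (Suc i)
  then show ?case
    using locally_constant_compose_continuous[OF Suc assms(2)] by (simp add: funpow_swap1)
qed (simp add: assms(1))

text \<open>
  A point of some period \<open>j \<le> L\<close> is fixed by the iterate of order \<open>fact L\<close>, so it suffices to take a
  point moved by that iterate.
\<close>

lemma point_without_short_period:
  fixes f :: "'a \<Rightarrow> 'a"
  assumes "\<And>n. n \<ge> 1 \<Longrightarrow> f ^^ n \<noteq> id"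
  obtains x where "\<And>j. 1 \<le> j \<Longrightarrow> j \<le> L \<Longrightarrow> (f ^^ j) x \<noteq> x"
proof -
  have "f ^^ fact L \<noteq> id" by (rule assms) (simp add: fact_ge_1)
  then obtain x where x: "(f ^^ fact L) x \<noteq> x" by (auto simp: fun_eq_iff)
  have "(f ^^ j) x \<noteq> x" if "1 \<le> j" "j \<le> L" for j
  proof
    assume j: "(f ^^ j) x = x"
    have "((f ^^ j) ^^ k) x = x" for k by (induction k) (simp_all add: j)
    moreover have "j dvd fact L" using that by (rule dvd_fact)
    then obtain k where "fact L = j * k" by (rule dvdE)
    ultimately show False using x by (simp add: funpow_mult)
  qed
  then show thesis by (rule that)
qed

text \<open>
  A point that differs from its first \<open>L\<close> iterates has a neighbourhood with no return in that
  time. Naming points by a code \<open>p\<close> fine enough to distinguish \<open>x\<close> from these iterates makes the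
  neighbourhood clopen.
\<close>

lemma clopen_without_short_return:
  fixes f :: "'a::metric_space \<Rightarrow> 'a"
  assumes X: "Cantor_space (UNIV :: 'a set)" and f: "continuous_on UNIV f"
    and aperiodic: "\<And>n. n \<ge> 1 \<Longrightarrow> f ^^ n \<noteq> id"
  obtains U where "U \<noteq> {}" "locally_constant (\<lambda>x. x \<in> U)"
    "\<And>x j. x \<in> U \<Longrightarrow> 1 \<le> j \<Longrightarrow> j \<le> L \<Longrightarrow> (f ^^ j) x \<notin> U"
proof -
  obtain x where x: "\<And>j. 1 \<le> j \<Longrightarrow> j \<le> L \<Longrightarrow> (f ^^ j) x \<noteq> x"
    using point_without_short_period[of f L] aperiodic by blast
  have "finite ((\<lambda>j. (f ^^ j) x) ` {1..L})" by simp
  then obtain e where e: "e > 0" "\<forall>y\<in>(\<lambda>j. (f ^^ j) x) ` {1..L}. y \<noteq> x \<longrightarrow> e \<le> dist x y"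
    by (blast dest: finite_set_avoid[of _ x])
  obtain p :: "'a \<Rightarrow> 'a set set" where p: "locally_constant p" "\<And>x y. p x = p y \<Longrightarrow> dist x y < e"
    using fine_locally_constant[OF X e(1)] by metis
  have px: "p ((f ^^ j) x) \<noteq> p x" if "j \<in> {1..L}" for j
  proof
    assume "p ((f ^^ j) x) = p x"
    then have "dist x ((f ^^ j) x) < e" by (intro p(2)) simp
    moreover have "e \<le> dist x ((f ^^ j) x)" using e(2) x[of j] that by simp
    ultimately show False by simp
  qed
  define U where "U = {y. p y = p x \<and> (\<forall>j\<in>{1..L}. p ((f ^^ j) y) \<noteq> p x)}"
  have "locally_constant (\<lambda>y. y \<in> U)"
  proof (rule locally_constant_finite_dependence[of "{0..L}" "\<lambda>j y. p ((f ^^ j) y)"])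
    fix y z assume yz: "\<And>j. j \<in> {0..L} \<Longrightarrow> p ((f ^^ j) z) = p ((f ^^ j) y)"
    have "p z = p y" using yz[of 0] by simp
    moreover have "p ((f ^^ j) z) = p ((f ^^ j) y)" if "j \<in> {1..L}" for j using yz that by simp
    ultimately show "(z \<in> U) = (y \<in> U)" by (simp add: U_def)
  qed (simp_all add: locally_constant_funpow[OF p(1) f])
  moreover have "x \<in> U" using px by (simp add: U_def)
  moreover have "(f ^^ j) y \<notin> U" if "y \<in> U" "1 \<le> j" "j \<le> L" for y j
    using that by (simp add: U_def)
  ultimately show thesis using that by blast
qed

text \<open>
  The time needed to enter \<open>U\<close>, truncated at \<open>L\<close> so that it depends only on the first \<open>L\<close> points of
  the orbit.
\<close>

definition hitting_time :: "('a \<Rightarrow> 'a) \<Rightarrow> 'a set \<Rightarrow> nat \<Rightarrow> 'a \<Rightarrow> nat" where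
  "hitting_time f U L x = (LEAST i. i = L \<or> (f ^^ i) x \<in> U)"

lemma hitting_time_le: "hitting_time f U L x \<le> L"
  unfolding hitting_time_def by (rule Least_le) simp

lemma hitting_time_hits: "hitting_time f U L x < L \<Longrightarrow> (f ^^ hitting_time f U L x) x \<in> U"
  unfolding hitting_time_def using LeastI[of "\<lambda>i. i = L \<or> (f ^^ i) x \<in> U" L] by auto

lemma hitting_time_eqI:
  assumes "k \<le> L" "\<And>i. i < k \<Longrightarrow> (f ^^ i) x \<notin> U" "k < L \<Longrightarrow> (f ^^ k) x \<in> U"
  shows "hitting_time f U L x = k"
  unfolding hitting_time_def
proof (rule Least_equality)
  show "k = L \<or> (f ^^ k) x \<in> U" using assms(1,3) le_neq_implies_less by blast
  show "k \<le> i" if "i = L \<or> (f ^^ i) x \<in> U" for i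
    using that assms(1,2) not_le_imp_less by blast
qed

text \<open>
  A point whose truncated hitting time is \<open>t\<close> is placed at the vertex \<open>v (L - t)\<close> of the walk. Points
  far away from \<open>U\<close> have \<open>t = L\<close> and wait at \<open>v 0\<close>, which the loop permits. Along an orbit \<open>t\<close> drops
  by one at each step until \<open>U\<close> is reached, at the vertex \<open>v L = v 0\<close>; since \<open>U\<close> has no return
  within \<open>L\<close> steps, the next hitting time is at least \<open>L - 1\<close>, so that the walk is started afresh at
  \<open>v 0\<close> or \<open>v 1\<close>. All edges occur because \<open>f\<close> is onto: points of \<open>U\<close> have preimages of every order.
\<close>

lemma realize_closed_walk:
  fixes f :: "'a::metric_space \<Rightarrow> 'a"
  assumes X: "Cantor_space (UNIV :: 'a set)" and f: "continuous_on UNIV f" "surj f"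
    and aperiodic: "\<And>n. n \<ge> 1 \<Longrightarrow> f ^^ n \<noteq> id"
    and v: "v L = v 0" "(v 0, v 0) \<in> edges v L"
  obtains q where "locally_constant q" "range (\<lambda>x. (q x, q (f x))) = edges v L"
proof -
  obtain U where U: "U \<noteq> {}" "locally_constant (\<lambda>x. x \<in> U)"
    "\<And>x j. x \<in> U \<Longrightarrow> 1 \<le> j \<Longrightarrow> j \<le> L \<Longrightarrow> (f ^^ j) x \<notin> U"
    using clopen_without_short_return[OF X f(1) aperiodic] by metis
  have "L > 0" using v(2) by (auto simp: edges_def)
  let ?\<tau> = "hitting_time f U L"
  define q where "q x = v (L - ?\<tau> x)" for x
  have "locally_constant q"
  proof (rule locally_constant_finite_dependence[of "{..<L}" "\<lambda>i x. (f ^^ i) x \<in> U"])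
    fix x y assume same: "\<And>i. i \<in> {..<L} \<Longrightarrow> ((f ^^ i) y \<in> U) = ((f ^^ i) x \<in> U)"
    have "?\<tau> y = ?\<tau> x"
    proof (rule hitting_time_eqI[OF hitting_time_le])
      fix i assume "i < ?\<tau> x"
      then have "i < L" "(f ^^ i) x \<notin> U"
        using hitting_time_le[of f U L x] not_less_Least[of i "\<lambda>i. i = L \<or> (f ^^ i) x \<in> U"]
        by (simp_all add: hitting_time_def)
      then show "(f ^^ i) y \<notin> U" using same[of i] by simp
    next
      assume "?\<tau> x < L"
      then show "(f ^^ ?\<tau> x) y \<in> U" using same[of "?\<tau> x"] hitting_time_hits by simp
    qed
    then show "q y = q x" by (simp add: q_def)
  qed (simp_all add: locally_constant_funpow[OF U(2) f(1)])
  moreover have "range (\<lambda>x. (q x, q (f x))) = edges v L"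
  proof (intro equalityI subsetI)
    fix e assume "e \<in> range (\<lambda>x. (q x, q (f x)))"
    then obtain x where x: "e = (q x, q (f x))" by blast
    \<comment> \<open>At \<open>v 0\<close> with a long time to go, an orbit either keeps waiting or makes the first step.\<close>
    have leaving: "e \<in> edges v L" if "q x = v 0" "?\<tau> (f x) \<ge> L - 1"
    proof -
      have "?\<tau> (f x) = L - 1 \<or> ?\<tau> (f x) = L"
        using that(2) hitting_time_le[of f U L "f x"] by linarith
      then have "q (f x) = v 1 \<or> q (f x) = v 0" using \<open>L > 0\<close> by (auto simp: q_def)
      moreover have "(v 0, v 1) \<in> edges v L" using \<open>L > 0\<close> by (force simp: edges_def)
      ultimately show ?thesis using that(1) v(2) x by auto
    qed
    have later: "Suc (?\<tau> (f x)) \<ge> ?\<tau> x"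
    proof (rule ccontr)
      assume "\<not> ?thesis"
      then have less: "Suc (?\<tau> (f x)) < ?\<tau> x" by simp
      then have "(f ^^ ?\<tau> (f x)) (f x) \<in> U"
        using hitting_time_le[of f U L x] by (intro hitting_time_hits) simp
      then have "(f ^^ Suc (?\<tau> (f x))) x \<in> U" by (simp add: funpow_swap1)
      then show False
        using less not_less_Least[of "Suc (?\<tau> (f x))" "\<lambda>i. i = L \<or> (f ^^ i) x \<in> U"]
        by (simp add: hitting_time_def)
    qed
    consider "?\<tau> x = 0" | "?\<tau> x = L" | k where "?\<tau> x = Suc k" "Suc k < L"
      using hitting_time_le[of f U L x] by (metis le_neq_implies_less not0_implies_Suc)
    then show "e \<in> edges v L"
    proof cases
      case 1
      then have "x \<in> U" using hitting_time_hits[of f U L x] \<open>L > 0\<close> by simp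
      have "?\<tau> (f x) \<ge> L - 1"
      proof (rule ccontr)
        assume "\<not> ?thesis"
        then have less: "Suc (?\<tau> (f x)) < L" by simp
        then have "(f ^^ ?\<tau> (f x)) (f x) \<in> U" by (intro hitting_time_hits) simp
        then have "(f ^^ Suc (?\<tau> (f x))) x \<in> U" by (simp add: funpow_swap1)
        then show False using U(3)[OF \<open>x \<in> U\<close>, of "Suc (?\<tau> (f x))"] less by simp
      qed
      then show ?thesis using 1 v(1) by (intro leaving) (simp_all add: q_def)
    next
      case 2
      then show ?thesis using later by (intro leaving) (simp_all add: q_def)
    next
      case 3
      have "(f ^^ k) (f x) \<in> U" using hitting_time_hits[of f U L x] 3 by (simp add: funpow_swap1)
      then have "?\<tau> (f x) \<le> k" unfolding hitting_time_def by (intro Least_le) simp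
      then have "?\<tau> (f x) = k" using later 3 by simp
      then have "e = (v (L - Suc k), v (Suc (L - Suc k)))"
        using x 3 by (simp add: q_def Suc_diff_Suc)
      then show ?thesis using 3 by (auto simp: edges_def)
    qed
  next
    fix e assume "e \<in> edges v L"
    then obtain i where i: "i < L" "e = (v i, v (Suc i))" by (auto simp: edges_def)
    obtain y where "y \<in> U" using U(1) by blast
    have "surj (f ^^ (L - i))" by (rule surj_fn[OF f(2)])
    then obtain z where z: "(f ^^ (L - i)) z = y" by (metis surjD)
    have \<tau>: "?\<tau> w = k" if "k \<le> L" "(f ^^ k) w = y" for k w
    proof (rule hitting_time_eqI[OF that(1)])
      show "(f ^^ k) w \<in> U" using that \<open>y \<in> U\<close> by simp
      fix j assume "j < k"
      show "(f ^^ j) w \<notin> U"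
      proof
        assume "(f ^^ j) w \<in> U"
        then have "(f ^^ (k - j)) ((f ^^ j) w) \<notin> U" using \<open>j < k\<close> that(1) by (intro U(3)) auto
        moreover have "(f ^^ (k - j)) ((f ^^ j) w) = (f ^^ k) w"
          using \<open>j < k\<close> by (simp add: funpow_add[symmetric, unfolded o_def fun_eq_iff, rule_format])
        ultimately show False using that(2) \<open>y \<in> U\<close> by simp
      qed
    qed
    have "?\<tau> z = L - i" using z by (intro \<tau>) auto
    moreover have "?\<tau> (f z) = L - Suc i"
    proof (rule \<tau>)
      have "(f ^^ Suc (L - Suc i)) z = y" using z i(1) by (simp add: Suc_diff_Suc)
      then show "(f ^^ (L - Suc i)) (f z) = y" by (simp add: funpow_swap1)
    qed simp
    ultimately have "e = (q z, q (f z))" using i by (simp add: q_def)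
    then show "e \<in> range (\<lambda>x. (q x, q (f x)))" by blast
  qed
  ultimately show thesis by (rule that)
qed

section \<open>Periodic maps\<close>

text \<open>
  A fibre \<open>C\<close> of an invariant code is infinite, while orbits are finite. So \<open>C\<close> contains two orbits,
  and the saturation of a small clopen neighbourhood of a point on one of them is an
  invariant clopen set that misses the other. Splitting it off adds one value at a time.
\<close>

lemma invariant_locally_constant_with_range:
  fixes f :: "'a::metric_space \<Rightarrow> 'a"
  assumes X: "Cantor_space (UNIV :: 'a set)" and f: "continuous_on UNIV f"
    and n: "n \<ge> 1" "f ^^ n = id"
    and A: "finite A" "A \<noteq> {}"
  shows "\<exists>q :: 'a \<Rightarrow> 'b. locally_constant q \<and> (\<forall>x. q (f x) = q x) \<and> range q = A"
  using A
proof (induction A rule: finite_ne_induct)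
  case (singleton a)
  show ?case by (intro exI[of _ "\<lambda>_. a"]) (auto simp: locally_constant_def)
next
  case (insert a A)
  obtain q :: "'a \<Rightarrow> 'b" where q: "locally_constant q" "\<And>x. q (f x) = q x" "range q = A"
    using insert.IH by blast
  obtain y where "q y \<in> A" using insert.hyps(2) q(3) by blast
  define C where "C = {x. q x = q y}"
  define orbit where "orbit = (\<lambda>j. (f ^^ j) y) ` {..<n}"
  have "y islimpt UNIV" using X by (simp add: Cantor_space_def)
  moreover have "open C" unfolding C_def by (rule locally_constant_fibre[OF q(1)])
  ultimately have "infinite C" by (simp add: islimpt_eq_acc_point C_def)
  moreover have "finite orbit" by (simp add: orbit_def)
  ultimately obtain x where x: "x \<in> C" "x \<notin> orbit" by (meson finite_subset subsetI)
  then obtain e where e: "e > 0" "\<forall>z\<in>orbit. z \<noteq> x \<longrightarrow> e \<le> dist x z"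
    using finite_set_avoid[OF \<open>finite orbit\<close>, of x] by blast
  obtain p :: "'a \<Rightarrow> 'a set set" where p: "locally_constant p" "\<And>x y. p x = p y \<Longrightarrow> dist x y < e"
    using fine_locally_constant[OF X e(1)] by metis
  define V where "V = {z. q z = q y \<and> (\<exists>j<n. p ((f ^^ j) z) = p x)}"
  have V_invariant: "f z \<in> V \<longleftrightarrow> z \<in> V" for z
  proof -
    have "(\<exists>j<n. p ((f ^^ j) (f z)) = p x) \<longleftrightarrow> (\<exists>j<n. p ((f ^^ j) z) = p x)"
    proof
      assume "\<exists>j<n. p ((f ^^ j) (f z)) = p x"
      then obtain j where j: "j < n" "p ((f ^^ Suc j) z) = p x" by (auto simp: funpow_swap1)
      show "\<exists>j<n. p ((f ^^ j) z) = p x"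
      proof (cases "Suc j = n")
        case True
        then show ?thesis using j n by (intro exI[of _ 0]) simp
      next
        case False
        then show ?thesis using j by (intro exI[of _ "Suc j"]) simp
      qed
    next
      assume "\<exists>j<n. p ((f ^^ j) z) = p x"
      then obtain j where j: "j < n" "p ((f ^^ j) z) = p x" by blast
      show "\<exists>j<n. p ((f ^^ j) (f z)) = p x"
      proof (cases j)
        case 0
        have "(f ^^ (n - 1)) (f z) = (f ^^ Suc (n - 1)) z" by (simp add: funpow_swap1)
        also have "\<dots> = z" using n by simp
        finally show ?thesis using j 0 n by (intro exI[of _ "n - 1"]) simp
      next
        case (Suc i)
        then show ?thesis using j by (intro exI[of _ i]) (simp add: funpow_swap1)
      qed
    qed
    then show ?thesis by (simp add: V_def q(2))
  qed
  have lc_V: "locally_constant (\<lambda>z. z \<in> V)"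
  proof (rule locally_constant_finite_dependence[of "{..<n}" "\<lambda>j z. (q z, p ((f ^^ j) z))"])
    show "locally_constant (\<lambda>z. (q z, p ((f ^^ j) z)))" for j
      by (rule locally_constant_Pair[OF q(1) locally_constant_funpow[OF p(1) f]])
    fix z w assume same: "\<And>j. j \<in> {..<n} \<Longrightarrow> (q w, p ((f ^^ j) w)) = (q z, p ((f ^^ j) z))"
    then have "q w = q z" using n(1) by auto
    moreover have "(\<exists>j<n. p ((f ^^ j) w) = p x) = (\<exists>j<n. p ((f ^^ j) z) = p x)"
      using same by auto
    ultimately show "(w \<in> V) = (z \<in> V)" by (simp add: V_def)
  qed simp
  have "x \<in> V" using x(1) n(1) by (auto simp: V_def C_def intro!: exI[of _ 0])
  have "y \<notin> V"
  proof
    assume "y \<in> V"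
    then obtain j where j: "j < n" "p ((f ^^ j) y) = p x" by (auto simp: V_def)
    then have "(f ^^ j) y \<in> orbit" by (simp add: orbit_def)
    moreover have "dist x ((f ^^ j) y) < e" by (intro p(2)) (simp add: j)
    ultimately show False using e(2) x(2) by (metis leD)
  qed
  define r where "r z = (if z \<in> V then a else q z)" for z
  have "locally_constant r"
  proof (rule locally_constant_finite_dependence[of "{()}" "\<lambda>_ z. (z \<in> V, q z)"])
    show "locally_constant (\<lambda>z. (z \<in> V, q z))" by (rule locally_constant_Pair[OF lc_V q(1)])
  qed (simp_all add: r_def)
  moreover have "r (f z) = r z" for z by (simp add: r_def V_invariant q(2))
  moreover have "range r = insert a A"
  proof (intro equalityI subsetI)
    fix b assume "b \<in> range r"
    then show "b \<in> insert a A" using q(3) by (auto simp: r_def)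
  next
    fix b assume "b \<in> insert a A"
    then consider "b = a" | z where "b = q z" "z \<notin> V" | z where "b = q z" "z \<in> V"
      using q(3) by blast
    then show "b \<in> range r"
    proof cases
      case 1
      then have "b = r x" using \<open>x \<in> V\<close> by (simp add: r_def)
      then show ?thesis by simp
    next
      case 2
      then have "b = r z" by (simp add: r_def)
      then show ?thesis by simp
    next
      case 3
      then have "q z = q y" by (simp add: V_def)
      then have "b = r y" using 3 \<open>y \<notin> V\<close> by (simp add: r_def)
      then show ?thesis by simp
    qed
  qed
  ultimately show ?case by blast
qed

lemma id_map_in_closure_of_periodic:
  fixes f :: "'a::metric_space \<Rightarrow>\<^sub>C 'a"
  assumes X: "Cantor_space (UNIV :: 'a set)" and f: "f \<in> cont_surj"
    and n: "n \<ge> 1" "apply_bcontfun f ^^ n = id"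
  shows "id_map \<in> top_of_set cont_surj closure_of conj_class f"
proof (rule conj_class_closure_criterion[OF X f])
  have "compact (UNIV :: 'a set)" using X by (simp add: Cantor_space_def)
  note id = apply_id_map[OF this]
  show "id_map \<in> (cont_surj :: ('a \<Rightarrow>\<^sub>C 'a) set)" by (simp add: cont_surj_def id)
  fix p :: "'a \<Rightarrow> 'a set set" assume p: "locally_constant p"
  obtain q :: "'a \<Rightarrow> 'a set set" where
    q: "locally_constant q" "\<And>x. q (apply_bcontfun f x) = q x" "range q = range p"
    using invariant_locally_constant_with_range[OF X _ n, of "range p"]
      locally_constant_finite_range[OF \<open>compact UNIV\<close> p] by auto
  have "range (\<lambda>x. (q x, q (apply_bcontfun f x))) = (\<lambda>b. (b, b)) ` range q"
    by (simp add: q(2) image_image)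
  also have "\<dots> = range (\<lambda>x. (p x, p (apply_bcontfun id_map x)))"
    unfolding q(3) by (simp add: id image_image)
  finally show "\<exists>q :: 'a \<Rightarrow> 'a set set. locally_constant q \<and> range (\<lambda>x. (q x, q (apply_bcontfun f x))) =
      range (\<lambda>x. (p x, p (apply_bcontfun id_map x)))"
    using q(1) by blast
qed

section \<open>Chain mixing maps\<close>

lemma mem_chain_step: "(x, y) \<in> V e O graph_of f O V e \<longleftrightarrow> (\<exists>z. dist x z < e \<and> dist (f z) y < e)"
  by (auto simp: V_def graph_of_def)

lemma relpow_map:
  assumes "\<And>x y. (x, y) \<in> R \<Longrightarrow> (h x, h y) \<in> S" "(x, y) \<in> R ^^ n"
  shows "(h x, h y) \<in> S ^^ n"
  using assms(2)
proof (induction n arbitrary: y)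
  case (Suc n)
  then show ?case using assms(1) by auto
qed simp

lemma relpow_subset:
  fixes R S :: "('a \<times> 'a) set"
  shows "R \<subseteq> S \<Longrightarrow> R ^^ n \<subseteq> S ^^ n"
  by (induction n) (simp_all add: relcomp_mono)

text \<open>
  Errors below the Lebesgue number of the partition are invisible to the code, so that chains
  become walks in the graph.
\<close>

lemma chain_mixing_coded:
  fixes f :: "'a::metric_space \<Rightarrow> 'a"
  assumes "compact (UNIV :: 'a set)" "chain_mixing f" "locally_constant p"
  obtains N where "N \<ge> 1" "\<And>x y. (p x, p y) \<in> range (\<lambda>x. (p x, p (f x))) ^^ N"
proof -
  obtain d where d: "d > 0" "\<And>x y. dist x y < d \<Longrightarrow> p x = p y"
    by (rule locally_constant_uniform[OF assms(1,3)]) blast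
  obtain N where N: "N \<ge> 1" "(V d O graph_of f O V d) ^^ N = UNIV \<times> UNIV"
    using assms(2) d(1) unfolding chain_mixing_def by blast
  have step: "(p x, p y) \<in> range (\<lambda>x. (p x, p (f x)))" if "(x, y) \<in> V d O graph_of f O V d" for x y
  proof -
    obtain z where "dist x z < d" "dist (f z) y < d" using \<open>_ \<in> _\<close> mem_chain_step by metis
    then have "p x = p z" "p y = p (f z)" using d(2) by metis+
    then show ?thesis by simp
  qed
  have "(p x, p y) \<in> range (\<lambda>x. (p x, p (f x))) ^^ N" for x y
  proof (rule relpow_map[OF step])
    show "(x, y) \<in> (V d O graph_of f O V d) ^^ N" unfolding N(2) by simp
  qed
  with N(1) show thesis by (rule that)
qed

text \<open>
  A periodic map admits an invariant code with two values, whose graph consists of two isolated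
  loops.
\<close>

lemma chain_mixing_aperiodic:
  fixes f :: "'a::metric_space \<Rightarrow> 'a"
  assumes X: "Cantor_space (UNIV :: 'a set)" and f: "continuous_on UNIV f"
    and mixing: "chain_mixing f" and "n \<ge> 1"
  shows "f ^^ n \<noteq> id"
proof
  assume "f ^^ n = id"
  then obtain q :: "'a \<Rightarrow> bool" where q: "locally_constant q" "\<And>x. q (f x) = q x" "range q = UNIV"
    using invariant_locally_constant_with_range[OF X f \<open>n \<ge> 1\<close>, of "UNIV :: bool set"] by auto
  have "compact (UNIV :: 'a set)" using X by (simp add: Cantor_space_def)
  then obtain N where N: "\<And>x y. (q x, q y) \<in> range (\<lambda>x. (q x, q (f x))) ^^ N"
    using chain_mixing_coded[OF _ mixing q(1)] by metis
  have "range (\<lambda>x. (q x, q (f x))) \<subseteq> Id" using q(2) by auto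
  then have "range (\<lambda>x. (q x, q (f x))) ^^ N \<subseteq> Id ^^ N" by (rule relpow_subset)
  also have "\<dots> = Id" by (induction N) auto
  finally have same: "q x = q y" for x y using N by auto
  have "True \<in> range q" "False \<in> range q" unfolding q(3) by simp_all
  then show False using same by blast
qed

lemma CM1_subset_closure_of_aperiodic:
  fixes f :: "'a::metric_space \<Rightarrow>\<^sub>C 'a"
  assumes X: "Cantor_space (UNIV :: 'a set)" and f: "f \<in> cont_surj"
    and aperiodic: "\<And>n. n \<ge> 1 \<Longrightarrow> apply_bcontfun f ^^ n \<noteq> id"
  shows "CM1 \<subseteq> top_of_set cont_surj closure_of conj_class f"
proof
  fix g :: "'a \<Rightarrow>\<^sub>C 'a" assume "g \<in> CM1"
  then have g: "g \<in> cont_surj" "chain_mixing (apply_bcontfun g)"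
    and "\<exists>x. apply_bcontfun g x = x" by (auto simp: CM1_def)
  then obtain x\<^sub>0 where x\<^sub>0: "apply_bcontfun g x\<^sub>0 = x\<^sub>0" by blast
  have compact: "compact (UNIV :: 'a set)" using X by (simp add: Cantor_space_def)
  show "g \<in> top_of_set cont_surj closure_of conj_class f"
  proof (rule conj_class_closure_criterion[OF X f g(1)])
    fix p :: "'a \<Rightarrow> 'a set set" assume p: "locally_constant p"
    let ?R = "range (\<lambda>x. (p x, p (apply_bcontfun g x)))"
    have "?R \<subseteq> range p \<times> range p" by auto
    then have finite: "finite ?R"
      using locally_constant_finite_range[OF compact p] by (meson finite_SigmaI finite_subset)
    obtain N where "\<And>x y. (p x, p y) \<in> ?R ^^ N"
      using chain_mixing_coded[OF compact g(2) p] by metis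
    then have connected: "(p x, p y) \<in> ?R\<^sup>*" for x y by (meson relpow_imp_rtrancl)
    have "\<exists>v n. v 0 = p x\<^sub>0 \<and> v n = p x\<^sub>0 \<and> edges v n \<subseteq> ?R \<and> ?R \<subseteq> edges v n"
      by (rule closed_walk_through_all_edges[OF finite]) (use connected in auto)
    then obtain v L where v: "v 0 = p x\<^sub>0" "v L = p x\<^sub>0" "edges v L = ?R" by blast
    have "(p x\<^sub>0, p (apply_bcontfun g x\<^sub>0)) \<in> ?R" by blast
    then have loop: "(v 0, v 0) \<in> edges v L" using v x\<^sub>0 by simp
    have "surj (apply_bcontfun f)" using f by (simp add: cont_surj_def)
    then obtain q where "locally_constant q" "range (\<lambda>x. (q x, q (apply_bcontfun f x))) = edges v L"
      using realize_closed_walk[OF X continuous_on_apply_bcontfun _ aperiodic _ loop] v by metis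
    then show "\<exists>q :: 'a \<Rightarrow> 'a set set. locally_constant q \<and>
        range (\<lambda>x. (q x, q (apply_bcontfun f x))) = ?R"
      using v(3) by blast
  qed
qed

lemma CM1_conj_invariant:
  assumes "compact (UNIV :: 'a::metric_space set)"
  shows "conj_invariant (CM1 :: ('a::metric_space \<Rightarrow>\<^sub>C 'a) set)"
  unfolding conj_invariant_def
proof (intro ballI subsetI)
  fix f g :: "'a \<Rightarrow>\<^sub>C 'a" assume f: "f \<in> CM1" and g: "g \<in> conj_class f"
  then obtain h where h: "h \<in> homeo_group" "\<forall>x. apply_bcontfun g (h x) = h (apply_bcontfun f x)"
    using conj_classD by metis
  have "f \<in> cont_surj" using f by (simp add: CM1_def)
  then have "g \<in> cont_surj" using g conj_class_subset_cont_surj by blast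
  moreover obtain x where "apply_bcontfun f x = x" using f by (auto simp: CM1_def)
  then have "apply_bcontfun g (h x) = h x" using h(2) by simp
  moreover have "chain_mixing (apply_bcontfun g)"
    unfolding chain_mixing_def
  proof (intro allI impI)
    fix e :: real assume "e > 0"
    have "uniformly_continuous_on UNIV h"
      using compact_uniformly_continuous[OF homeo_groupD(1)[OF h(1)] assms] .
    then obtain d where d: "d > 0" "\<And>x y. dist x y < d \<Longrightarrow> dist (h x) (h y) < e"
      using \<open>e > 0\<close> by (metis UNIV_I uniformly_continuous_onE)
    obtain N where N: "N \<ge> 1" "(V d O graph_of (apply_bcontfun f) O V d) ^^ N = UNIV \<times> UNIV"
      using f d(1) by (auto simp: CM1_def chain_mixing_def)
    have step: "(h x, h y) \<in> V e O graph_of (apply_bcontfun g) O V e"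
      if "(x, y) \<in> V d O graph_of (apply_bcontfun f) O V d" for x y
      using that h(2) d(2) unfolding mem_chain_step by metis
    have "(x, y) \<in> (V e O graph_of (apply_bcontfun g) O V e) ^^ N" for x y
    proof -
      have "(inv h x, inv h y) \<in> (V d O graph_of (apply_bcontfun f) O V d) ^^ N"
        unfolding N(2) by simp
      from relpow_map[where h = h, OF step this] show ?thesis by (simp add: homeo_groupD(4)[OF h(1)])
    qed
    then show "\<exists>N\<ge>1. (V e O graph_of (apply_bcontfun g) O V e) ^^ N = UNIV \<times> UNIV"
      using N(1) by (intro exI[of _ N]) auto
  qed
  ultimately show "g \<in> CM1" by (auto simp: CM1_def)
qed

text \<open>
  Chain mixing at scale \<open>e\<close> follows from chain mixing at scale \<open>e / 2\<close> of any map at distance below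
  \<open>e / 2\<close>. A map without fixed points moves all points by a definite amount, by
  compactness, and so do the maps near it.
\<close>

lemma CM1_closedin:
  assumes compact: "compact (UNIV :: 'a::metric_space set)"
  shows "closedin (top_of_set cont_surj) (CM1 :: ('a::metric_space \<Rightarrow>\<^sub>C 'a) set)"
proof -
  have "f \<in> CM1" if f: "f \<in> cont_surj" "f \<in> closure CM1" for f :: "'a \<Rightarrow>\<^sub>C 'a"
  proof -
    have approx: "\<exists>g\<in>CM1. \<forall>x. dist (apply_bcontfun g x) (apply_bcontfun f x) < e" if "e > 0" for e
      using f(2) that unfolding closure_approachable by (meson dist_fun_lt_imp_dist_val_lt)
    have "chain_mixing (apply_bcontfun f)"
      unfolding chain_mixing_def
    proof (intro allI impI)
      fix e :: real assume "e > 0"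
      then obtain g where g: "g \<in> CM1" "\<And>x. dist (apply_bcontfun g x) (apply_bcontfun f x) < e/2"
        using approx[of "e/2"] by auto
      then have "chain_mixing (apply_bcontfun g)" by (simp add: CM1_def)
      then obtain N where N: "N \<ge> 1" "(V (e/2) O graph_of (apply_bcontfun g) O V (e/2)) ^^ N = UNIV \<times> UNIV"
        using \<open>e > 0\<close> half_gt_zero unfolding chain_mixing_def by blast
      have "V (e/2) O graph_of (apply_bcontfun g) O V (e/2) \<subseteq> V e O graph_of (apply_bcontfun f) O V e"
      proof (intro subrelI)
        fix x y assume "(x, y) \<in> V (e/2) O graph_of (apply_bcontfun g) O V (e/2)"
        then obtain z where z: "dist x z < e/2" "dist (apply_bcontfun g z) y < e/2"
          unfolding mem_chain_step by blast
        have "dist (apply_bcontfun f z) y < e"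
          using dist_triangle_half_r[OF g(2) z(2)] .
        moreover have "dist x z < e" using z(1) \<open>e > 0\<close> by simp
        ultimately show "(x, y) \<in> V e O graph_of (apply_bcontfun f) O V e"
          unfolding mem_chain_step by blast
      qed
      then have "UNIV \<times> UNIV \<subseteq> (V e O graph_of (apply_bcontfun f) O V e) ^^ N"
        unfolding N(2)[symmetric] by (rule relpow_subset)
      then show "\<exists>N\<ge>1. (V e O graph_of (apply_bcontfun f) O V e) ^^ N = UNIV \<times> UNIV"
        using N(1) by (intro exI[of _ N]) auto
    qed
    moreover have "\<exists>x. apply_bcontfun f x = x"
    proof -
      have "continuous_on UNIV (\<lambda>x. dist (apply_bcontfun f x) x)"
        by (intro continuous_on_dist continuous_on_apply_bcontfun continuous_on_id)
      from continuous_attains_inf[OF compact _ this]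
      obtain x where x: "\<And>y. dist (apply_bcontfun f x) x \<le> dist (apply_bcontfun f y) y" by auto
      have "dist (apply_bcontfun f x) x = 0"
      proof (rule ccontr)
        assume "\<not> ?thesis"
        then obtain g where g: "g \<in> CM1"
          "\<And>y. dist (apply_bcontfun g y) (apply_bcontfun f y) < dist (apply_bcontfun f x) x"
          using approx[of "dist (apply_bcontfun f x) x"] by auto
        obtain y where "apply_bcontfun g y = y" using g(1) by (auto simp: CM1_def)
        then show False using g(2)[of y] x[of y] by (simp add: dist_commute)
      qed
      then show ?thesis by auto
    qed
    ultimately show ?thesis using f(1) by (auto simp: CM1_def)
  qed
  moreover have "CM1 \<subseteq> (cont_surj :: ('a \<Rightarrow>\<^sub>C 'a) set)" by (auto simp: CM1_def)
  ultimately have eq: "CM1 = cont_surj \<inter> closure (CM1 :: ('a \<Rightarrow>\<^sub>C 'a) set)"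
    using closure_subset[of "CM1 :: ('a \<Rightarrow>\<^sub>C 'a) set"] by blast
  show ?thesis unfolding closedin_closed by (rule exI, rule conjI[OF closed_closure eq])
qed

text \<open>
  An orbit is a chain without errors; the tolerance is used up by the first step only.
\<close>

lemma relpow_chain_orbit:
  fixes f :: "'a::metric_space \<Rightarrow> 'a"
  assumes "e > 0" "dist x z < e"
  shows "(x, (f ^^ Suc n) z) \<in> (V e O graph_of f O V e) ^^ Suc n"
proof (induction n)
  case 0
  have "(x, f z) \<in> V e O graph_of f O V e" unfolding mem_chain_step using assms by auto
  then show ?case by simp
next
  case (Suc n)
  have "((f ^^ Suc n) z, (f ^^ Suc (Suc n)) z) \<in> V e O graph_of f O V e"
    unfolding mem_chain_step using assms(1) by (intro exI[of _ "(f ^^ Suc n) z"]) simp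
  with Suc show ?case by (rule relpow_Suc_I)
qed

text \<open>
  The pairs at distance at least \<open>e\<close> whose sequences agree up to \<open>n\<close> form a decreasing sequence of
  compact sets; by injectivity its intersection is empty.
\<close>

lemma agreeing_prefix_imp_close:
  fixes \<phi> :: "'a::metric_space \<Rightarrow> nat \<Rightarrow> 'b::t2_space"
  assumes compact: "compact (UNIV :: 'a set)" and cont: "\<And>i. continuous_on UNIV (\<lambda>x. \<phi> x i)"
    and "inj \<phi>" "e > 0"
  shows "\<exists>n. \<forall>x y. (\<forall>i<n. \<phi> x i = \<phi> y i) \<longrightarrow> dist x y < e"
proof -
  define F where "F n = {z. e \<le> dist (fst z) (snd z)} \<inter> (\<Inter>i\<in>{..<n}. {z. \<phi> (fst z) i = \<phi> (snd z) i})" for n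
  have "\<exists>n. F n = {}"
  proof (rule ccontr)
    assume nonempty: "\<nexists>n. F n = {}"
    have "compact (UNIV :: ('a \<times> 'a) set)" using compact_Times[OF compact compact] by simp
    then have "UNIV \<inter> (\<Inter>n\<in>UNIV. F n) \<noteq> {}"
    proof (rule compact_imp_fip_image)
      have c: "continuous_on UNIV (\<lambda>z :: 'a \<times> 'a. \<phi> (fst z) i)"
        "continuous_on UNIV (\<lambda>z :: 'a \<times> 'a. \<phi> (snd z) i)" for i
        by (intro continuous_on_compose2[OF cont] continuous_intros; simp)+
      show "closed (F n)" for n
        unfolding F_def
        by (intro closed_Int closed_INT ballI closed_Collect_le closed_Collect_eq c continuous_intros)
      fix I :: "nat set" assume "finite I"
      then obtain m where "\<forall>i\<in>I. i \<le> m" using finite_nat_set_iff_bounded_le by blast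
      then have "F m \<subseteq> (\<Inter>n\<in>I. F n)" by (auto simp: F_def)
      then show "UNIV \<inter> (\<Inter>n\<in>I. F n) \<noteq> {}" using nonempty by blast
    qed
    then obtain z where z: "\<And>n. z \<in> F n" by blast
    have "\<phi> (fst z) i = \<phi> (snd z) i" for i using z[of "Suc i"] by (simp add: F_def)
    then have "fst z = snd z" using \<open>inj \<phi>\<close> by (meson ext injD)
    then show False using z[of 0] \<open>e > 0\<close> by (simp add: F_def)
  qed
  then obtain n where n: "F n = {}" ..
  have "dist x y < e" if "\<forall>i<n. \<phi> x i = \<phi> y i" for x y
  proof (rule ccontr)
    assume "\<not> dist x y < e"
    then have "(x, y) \<in> F n" using that by (simp add: F_def)
    then show False using n by simp
  qed
  then show ?thesis by blast
qed

text \<open>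
  The one-sided shift on binary sequences is chain mixing without any intermediate correction: the
  sequence that begins like \<open>x\<close> and continues with \<open>y\<close> is close to \<open>x\<close> and is shifted onto \<open>y\<close>.
\<close>

lemma CM1_nonempty:
  assumes X: "Cantor_space (UNIV :: 'a::metric_space set)"
  shows "(CM1 :: ('a::metric_space \<Rightarrow>\<^sub>C 'a) set) \<noteq> {}"
proof -
  have compact: "compact (UNIV :: 'a set)" using X by (simp add: Cantor_space_def)
  obtain \<phi> \<psi> where "homeomorphism (UNIV :: 'a set) (UNIV :: (nat \<Rightarrow> bool) set) \<phi> \<psi>"
    using Cantor_space_homeomorphic_binary_sequences[OF X] by (auto simp: homeomorphic_def)
  then have \<phi>: "continuous_on UNIV \<phi>" "continuous_on UNIV \<psi>" "\<And>x. \<psi> (\<phi> x) = x" "\<And>b. \<phi> (\<psi> b) = b"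
    by (auto simp: homeomorphism_def)
  define \<sigma> where "\<sigma> x = \<psi> (\<lambda>i. \<phi> x (Suc i))" for x
  have coord: "continuous_on UNIV (\<lambda>x. \<phi> x i)" for i
    using \<phi>(1) by (rule continuous_on_product_then_coordinatewise)
  have "continuous_on UNIV \<sigma>"
    unfolding \<sigma>_def
    by (rule continuous_on_compose2[OF \<phi>(2)]) (auto intro!: continuous_on_coordinatewise_then_product coord)
  moreover have "bounded (range \<sigma>)" using compact_imp_bounded[OF compact] bounded_subset by blast
  ultimately have \<sigma>: "apply_bcontfun (Bcontfun \<sigma>) = \<sigma>"
    by (intro Bcontfun_inverse) (simp add: bcontfun_def)
  have "surj \<sigma>"
  proof (rule surjI)
    show "\<sigma> (\<psi> (case_nat True (\<phi> y))) = y" for y by (simp add: \<sigma>_def \<phi>)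
  qed
  moreover have "\<sigma> (\<psi> (\<lambda>_. True)) = \<psi> (\<lambda>_. True)" by (simp add: \<sigma>_def \<phi>)
  moreover have "chain_mixing \<sigma>"
    unfolding chain_mixing_def
  proof (intro allI impI)
    fix e :: real assume "e > 0"
    have "inj \<phi>" using \<phi>(3) by (metis injI)
    from agreeing_prefix_imp_close[OF compact coord this \<open>e > 0\<close>]
    obtain n where n: "\<forall>x y. (\<forall>i<n. \<phi> x i = \<phi> y i) \<longrightarrow> dist x y < e" ..
    have "(x, y) \<in> (V e O graph_of \<sigma> O V e) ^^ Suc n" for x y
    proof -
      define z where "z = \<psi> (\<lambda>i. if i < Suc n then \<phi> x i else \<phi> y (i - Suc n))"
      have "(\<sigma> ^^ k) w = \<psi> (\<lambda>i. \<phi> w (i + k))" for k w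
        by (induction k) (simp_all add: \<sigma>_def \<phi>)
      then have "(\<sigma> ^^ Suc n) z = y" by (simp add: z_def \<phi> del: funpow.simps)
      moreover have "dist x z < e" by (rule n[rule_format]) (simp add: z_def \<phi>)
      ultimately show ?thesis
        using relpow_chain_orbit[where f = \<sigma>, OF \<open>e > 0\<close>, of x z n] by (simp only:)
    qed
    then show "\<exists>N\<ge>1. (V e O graph_of \<sigma> O V e) ^^ N = UNIV \<times> UNIV"
      by (intro exI[of _ "Suc n"]) auto
  qed
  ultimately have "Bcontfun \<sigma> \<in> CM1" by (auto simp: CM1_def cont_surj_def \<sigma>)
  then show ?thesis by blast
qed

section \<open>The classification\<close>

lemma closure_of_conj_class_subset:
  assumes "closedin (top_of_set cont_surj) K" "conj_invariant K" "f \<in> K"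
  shows "top_of_set cont_surj closure_of conj_class f \<subseteq> K"
  using assms by (intro closure_of_minimal) (auto simp: conj_invariant_def)

lemma closure_of_conj_class_id_map:
  assumes "compact (UNIV :: 'a::metric_space set)"
  shows "closedin (top_of_set cont_surj) {id_map :: 'a::metric_space \<Rightarrow>\<^sub>C 'a}"
    and "top_of_set cont_surj closure_of conj_class (id_map :: 'a \<Rightarrow>\<^sub>C 'a) = {id_map}"
proof -
  have "(id_map :: 'a \<Rightarrow>\<^sub>C 'a) \<in> cont_surj" by (simp add: cont_surj_def apply_id_map[OF assms])
  then show "closedin (top_of_set cont_surj) {id_map :: 'a \<Rightarrow>\<^sub>C 'a}"
    by (auto simp: closedin_closed intro!: exI[of _ "{id_map}"])
  then show "top_of_set cont_surj closure_of conj_class (id_map :: 'a \<Rightarrow>\<^sub>C 'a) = {id_map}"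
    by (simp add: conj_class_id_map[OF assms] closure_of_closedin)
qed

theorem corollary4p18:
  fixes K :: "('a::metric_space \<Rightarrow>\<^sub>C 'a) set"
  assumes "Cantor_space (UNIV :: 'a set)"
  shows "conj_minimal K \<longleftrightarrow> K = {id_map} \<or> K = CM1"
proof
  have compact: "compact (UNIV :: 'a set)" using assms by (simp add: Cantor_space_def)
  note CM1 = CM1_closedin[OF compact] CM1_conj_invariant[OF compact]
  show "K = {id_map} \<or> K = CM1" if K: "conj_minimal K"
  proof -
    obtain f where f: "f \<in> K" using K by (auto simp: conj_minimal_def)
    have closure: "top_of_set cont_surj closure_of conj_class g = K" if "g \<in> K" for g
      using K that by (simp add: conj_minimal_def)
    have "f \<in> cont_surj" using K f closedin_subset by (fastforce simp: conj_minimal_def)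
    show ?thesis
    proof (cases "\<exists>n\<ge>1. apply_bcontfun f ^^ n = id")
      case True
      then have "id_map \<in> K"
        using id_map_in_closure_of_periodic[OF assms \<open>f \<in> cont_surj\<close>] closure[OF f] by auto
      then have "K = {id_map}" using closure closure_of_conj_class_id_map(2)[OF compact] by metis
      then show ?thesis ..
    next
      case False
      then have "CM1 \<subseteq> K"
        using CM1_subset_closure_of_aperiodic[OF assms \<open>f \<in> cont_surj\<close>] closure[OF f] by auto
      moreover obtain g :: "'a \<Rightarrow>\<^sub>C 'a" where "g \<in> CM1" using CM1_nonempty[OF assms] by blast
      moreover have "top_of_set cont_surj closure_of conj_class g \<subseteq> CM1"
        using CM1 \<open>g \<in> CM1\<close> by (rule closure_of_conj_class_subset)
      ultimately have "K = CM1" using closure[of g] by blast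
      then show ?thesis ..
    qed
  qed
  have "conj_minimal {id_map :: 'a \<Rightarrow>\<^sub>C 'a}"
    unfolding conj_minimal_def conj_invariant_def
    using closure_of_conj_class_id_map[OF compact] conj_class_id_map[OF compact] by simp
  moreover have "conj_minimal (CM1 :: ('a \<Rightarrow>\<^sub>C 'a) set)"
    unfolding conj_minimal_def
  proof (intro conjI ballI CM1 CM1_nonempty[OF assms] equalityI)
    fix f :: "'a \<Rightarrow>\<^sub>C 'a" assume f: "f \<in> CM1"
    show "top_of_set cont_surj closure_of conj_class f \<subseteq> CM1"
      using CM1 f by (rule closure_of_conj_class_subset)
    have "f \<in> cont_surj" "chain_mixing (apply_bcontfun f)" using f by (simp_all add: CM1_def)
    then show "CM1 \<subseteq> top_of_set cont_surj closure_of conj_class f"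
      by (intro CM1_subset_closure_of_aperiodic[OF assms] chain_mixing_aperiodic[OF assms]
            continuous_on_apply_bcontfun)
  qed
  ultimately show "conj_minimal K" if "K = {id_map} \<or> K = CM1" using that by blast
qed

end
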